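(* Let $M,N\ge 1$ be integers, let $\mathcal{N}_m\subseteq\{0,1,\dots,N-1\}$ for $m=0,\dots,M-1$ be the sets of subcarriers used for sensing, and let $\Delta f>0$, $A>0$, $N_0>0$ be known. Suppose the observations are $$Y_m[i]=A\,e^{-j(2\pi i\Delta f\tau-\phi)}+W_m[i],\qquad m=0,\dots,M-1,\ i\in\mathcal{N}_m,$$ where the delay $\tau$ and the phase $\phi$ are unknown deterministic real parameters and the $W_m[i]$ are independent circularly symmetric complex Gaussian noise samples with variance $N_0/2$ per real dimension. Put $$g_1=\sum_{m=0}^{M-1}\sum_{i\in\mathcal{N}_m}(2\pi\Delta f\, i)^2,\qquad g_2=\Big(\sum_{m=0}^{M-1}\sum_{i\in\mathcal{N}_m}2\pi\Delta f\, i\Big)^2 ,$$ and assume $\big(\sum_{m=0}^{M-1}|\mathcal{N}_m|\big)g_1-g_2\neq 0$. Then the Cramér-Rao lower bound for $\tau$ (with $\phi$ jointly unknown) is as follows: the variance $\sigma_\tau^2$ of any unbiased estimator of $\tau$ satisfies $$\sigma_\tau^2\ \ge\ \frac{N_0}{2A^2}\cdot\frac{\sum_{m=0}^{M-1}|\mathcal{N}_m|}{\big(\sum_{m=0}^{M-1}|\mathcal{N}_m|\big)\,g_1-g_2}.$$ In particular, if $\mathcal{N}_m=\mathcal{N}_0$ for all $m$, then $$\sigma_\tau^2\ \ge\ \frac{N_0}{2MA^2}\cdot\frac{|\mathcal{N}_0|}{|\mathcal{N}_0|\sum_{i\in\mathcal{N}_0}(2\pi\Delta f\,i)^2-\big(\sum_{i\in\mathcal{N}_0}2\pi\Delta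 f\,i\big)^2}.$$
   Context: Here $j=\sqrt{-1}$ and $|\mathcal{S}|$ denotes the cardinality of a set $\mathcal{S}$. The model is a single-target OFDM sensing model: $\Delta f$ is the subcarrier spacing, $m$ indexes OFDM symbols, $i$ indexes subcarriers, $A$ is the amplitude of the channel gain and $\phi$ its phase; Doppler is not included. The joint density of the observations given $(\tau,\phi)$ is $\prod_{m}\prod_{i\in\mathcal{N}_m}\frac{1}{\pi N_0}\exp\big(-|Y_m[i]-Ae^{-j(2\pi i\Delta f\tau-\phi)}|^2/N_0\big)$. The parameter $(\tau,\phi)$ ranges over a nonempty open subset of $\mathbb{R}^2$. An unbiased estimator of $\tau$ is a measurable real function $\hat\tau$ of the observations with $\mathbb{E}_{\tau,\phi}[\hat\tau]=\tau$ for all $(\tau,\phi)$ in this open set, and $\sigma_\tau^2$ is its variance under $(\tau,\phi)$. The Cramér-Rao lower bound for $\tau$ is the $(\tau,\tau)$ entry of the inverse of the $2\times 2$ Fisher information matrix for $(\tau,\phi)$. *)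

theory Defs
  imports "HOL-Probability.Probability"
begin

text \<open>A statistical model is given by a family of laws \<open>P \<theta>\<close> and densities \<open>p \<theta>\<close>, indexed by
  a vector parameter \<open>\<theta>\<close>.\<close>

definition score :: "(real^'n \<Rightarrow> 'b \<Rightarrow> real) \<Rightarrow> real^'n \<Rightarrow> 'n \<Rightarrow> 'b \<Rightarrow> real" where
  "score p \<theta> a y = deriv (\<lambda>t. ln (p (\<theta> + t *\<^sub>R axis a 1) y)) 0"

definition fisher_information ::
    "(real^'n \<Rightarrow> 'b measure) \<Rightarrow> (real^'n \<Rightarrow> 'b \<Rightarrow> real) \<Rightarrow> real^'n \<Rightarrow> real^'n^'n" where
  "fisher_information P p \<theta> = (\<chi> a b. \<integral>y. score p \<theta> a y * score p \<theta> b y \<partial>(P \<theta>))"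

definition cramer_rao_bound ::
    "(real^'n \<Rightarrow> 'b measure) \<Rightarrow> (real^'n \<Rightarrow> 'b \<Rightarrow> real) \<Rightarrow> real^'n \<Rightarrow> 'n \<Rightarrow> real" where
  "cramer_rao_bound P p \<theta> a = matrix_inv (fisher_information P p \<theta>) $ a $ a"

text \<open>All \<open>P \<theta>\<close> are understood to live on the measurable space \<open>X\<close>.\<close>

definition unbiased_estimator ::
    "'b measure \<Rightarrow> (real^'n \<Rightarrow> 'b measure) \<Rightarrow> (real^'n) set \<Rightarrow> 'n \<Rightarrow> ('b \<Rightarrow> real) \<Rightarrow> bool" where
  "unbiased_estimator X P \<Theta> a T \<longleftrightarrow>
     T \<in> borel_measurable X \<and>
     (\<forall>\<theta>\<in>\<Theta>. integrable (P \<theta>) T \<and> (\<integral>y. T y \<partial>(P \<theta>)) = \<theta> $ a)"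

text \<open>The variance is extended-valued: with the Bochner integral an estimator of infinite variance
  would get variance \<open>0\<close>.\<close>

definition estimator_variance :: "'b measure \<Rightarrow> ('b \<Rightarrow> real) \<Rightarrow> ennreal" where
  "estimator_variance Q T = (\<integral>\<^sup>+y. ennreal ((T y - (\<integral>z. T z \<partial>Q))\<^sup>2) \<partial>Q)"

text \<open>\<open>v\<close> is the variance per real dimension.\<close>

definition circular_complex_gaussian :: "'a measure \<Rightarrow> ('a \<Rightarrow> complex) \<Rightarrow> real \<Rightarrow> bool" where
  "circular_complex_gaussian \<Omega> X v \<longleftrightarrow>
     prob_space.indep_var \<Omega> borel (\<lambda>\<omega>. Re (X \<omega>)) borel (\<lambda>\<omega>. Im (X \<omega>)) \<and>
     distributed \<Omega> lborel (\<lambda>\<omega>. Re (X \<omega>)) (\<lambda>x. ennreal (normal_density 0 (sqrt v) x)) \<and>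
     distributed \<Omega> lborel (\<lambda>\<omega>. Im (X \<omega>)) (\<lambda>x. ennreal (normal_density 0 (sqrt v) x))"

text \<open>In the OFDM model the parameter is \<open>\<theta> = (\<tau>, \<phi>)\<close>: \<open>\<theta> $ 1\<close> is the delay and
  \<open>\<theta> $ 2\<close> the phase. An observation is indexed by pairs \<open>(m, i)\<close> of symbol and subcarrier.\<close>

definition sensing_indices :: "nat \<Rightarrow> (nat \<Rightarrow> nat set) \<Rightarrow> (nat \<times> nat) set" where
  "sensing_indices M S = (SIGMA m:{..<M}. S m)"

definition echo :: "real \<Rightarrow> real \<Rightarrow> real^2 \<Rightarrow> nat \<Rightarrow> complex" where
  "echo A \<Delta>f \<theta> i =
     of_real A * exp (- (\<i> * of_real (2 * pi * real i * \<Delta>f * \<theta> $ 1 - \<theta> $ 2)))"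

definition observation ::
    "(nat \<times> nat) set \<Rightarrow> real \<Rightarrow> real \<Rightarrow> (nat \<Rightarrow> nat \<Rightarrow> 'a \<Rightarrow> complex) \<Rightarrow> real^2 \<Rightarrow> 'a
      \<Rightarrow> (nat \<times> nat \<Rightarrow> complex)" where
  "observation I A \<Delta>f W \<theta> \<omega> = (\<lambda>(m, i)\<in>I. echo A \<Delta>f \<theta> i + W m i \<omega>)"

abbreviation observation_space :: "(nat \<times> nat) set \<Rightarrow> (nat \<times> nat \<Rightarrow> complex) measure" where
  "observation_space I \<equiv> Pi\<^sub>M I (\<lambda>_. borel)"

definition observation_law ::
    "'a measure \<Rightarrow> (nat \<times> nat) set \<Rightarrow> real \<Rightarrow> real \<Rightarrow> (nat \<Rightarrow> nat \<Rightarrow> 'a \<Rightarrow> complex) \<Rightarrow> real^2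
      \<Rightarrow> (nat \<times> nat \<Rightarrow> complex) measure" where
  "observation_law \<Omega> I A \<Delta>f W \<theta> = distr \<Omega> (observation_space I) (observation I A \<Delta>f W \<theta>)"

definition likelihood ::
    "(nat \<times> nat) set \<Rightarrow> real \<Rightarrow> real \<Rightarrow> real \<Rightarrow> real^2 \<Rightarrow> (nat \<times> nat \<Rightarrow> complex) \<Rightarrow> real" where
  "likelihood I A \<Delta>f N0 \<theta> y =
     (\<Prod>(m, i)\<in>I. 1 / (pi * N0) * exp (- (cmod (y (m, i) - echo A \<Delta>f \<theta> i))\<^sup>2 / N0))"

end

theory Submission
  imports Defs "HOL-Real_Asymp.Real_Asymp"
begin

text \<open>The bound is obtained from the Hammersley--Chapman--Robbins inequality
  \<open>(E\<^sub>\<mu>\<^sub>' T - E\<^sub>\<mu> T)\<^sup>2 \<le> \<chi>\<^sup>2(\<mu>', \<mu>) Var\<^sub>\<mu> T\<close>, which is a Cauchy--Schwarz inequality and requires no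
  differentiation under the integral sign. For Gaussian laws with means \<open>\<mu>\<close>, \<open>\<mu>'\<close> the divergence is
  \<open>exp (2 \<bar>\<mu>' - \<mu>\<bar>\<^sup>2 / N0) - 1\<close>, because \<open>p\<^sub>\<mu>\<^sub>'\<^sup>2 / p\<^sub>\<mu>\<close> is a multiple of the density with mean \<open>2\<mu>' - \<mu>\<close>.
  Moving the parameter from \<open>\<theta>\<close> to \<open>\<theta> + t v\<close>, dividing by \<open>t\<^sup>2\<close> and letting \<open>t \<rightarrow> 0\<close> gives the
  Cramer--Rao inequality in the direction \<open>v\<close>, and \<open>v\<close> is then chosen optimally.\<close>

section \<open>Gaussian noise densities on finite products of the complex plane\<close>

text \<open>A product measure is determined by its values on boxes, and over a box the integral of a
  product of one-coordinate functions factors. The sigma-finiteness hypotheses range over all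
  indices, as \<open>product_sigma_finite\<close> demands.\<close>

lemma density_PiM:
  fixes f :: "'i \<Rightarrow> 'b \<Rightarrow> ennreal"
  assumes fin: "finite I"
    and sf: "\<And>i. sigma_finite_measure (M i)"
    and sfd: "\<And>i. sigma_finite_measure (density (M i) (f i))"
    and meas [measurable]: "\<And>i. f i \<in> borel_measurable (M i)"
  shows "density (Pi\<^sub>M I M) (\<lambda>y. \<Prod>i\<in>I. f i (y i)) = Pi\<^sub>M I (\<lambda>i. density (M i) (f i))"
proof -
  interpret M: product_sigma_finite M
    using sf by (simp add: product_sigma_finite_def)
  interpret D: product_sigma_finite "\<lambda>i. density (M i) (f i)"
    using sfd by (simp add: product_sigma_finite_def)
  show ?thesis
  proof (rule D.PiM_eqI[OF fin])
    show "sets (density (Pi\<^sub>M I M) (\<lambda>y. \<Prod>i\<in>I. f i (y i))) = sets (Pi\<^sub>M I (\<lambda>i. density (M i) (f i)))"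
      by (auto intro!: sets_PiM_cong)
    fix A assume "\<And>i. i \<in> I \<Longrightarrow> A i \<in> sets (density (M i) (f i))"
    then have A: "A i \<in> sets (M i)" if "i \<in> I" for i
      using that by simp
    have [measurable]: "Pi\<^sub>E I A \<in> sets (Pi\<^sub>M I M)"
      using A fin by (intro sets_PiM_I_finite) auto
    have "emeasure (density (Pi\<^sub>M I M) (\<lambda>y. \<Prod>i\<in>I. f i (y i))) (Pi\<^sub>E I A)
      = (\<integral>\<^sup>+y. (\<Prod>i\<in>I. f i (y i)) * indicator (Pi\<^sub>E I A) y \<partial>Pi\<^sub>M I M)"
      using fin by (intro emeasure_density) measurable
    also have "\<dots> = (\<integral>\<^sup>+y. (\<Prod>i\<in>I. f i (y i) * indicator (A i) (y i)) \<partial>Pi\<^sub>M I M)"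
    proof (intro nn_integral_cong)
      fix y assume "y \<in> space (Pi\<^sub>M I M)"
      \<comment> \<open>Membership in \<open>Pi\<^sub>E I A\<close> also demands the value
        \<open>undefined\<close> off \<open>I\<close>. Extensionality of \<open>y\<close> settles
        this, so the indicator is the product of the coordinate indicators.\<close>
      then have "y \<in> extensional I" by (simp add: space_PiM PiE_def)
      then have "indicator (Pi\<^sub>E I A) y = (\<Prod>i\<in>I. indicator (A i) (y i) :: ennreal)"
        using fin by (auto simp: indicator_def PiE_def Pi_def)
      then show "(\<Prod>i\<in>I. f i (y i)) * indicator (Pi\<^sub>E I A) y
          = (\<Prod>i\<in>I. f i (y i) * indicator (A i) (y i))"
        by (simp add: prod.distrib)
    qed
    also have "\<dots> = (\<Prod>i\<in>I. \<integral>\<^sup>+z. f i z * indicator (A i) z \<partial>M i)"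
      using A fin by (intro M.product_nn_integral_prod) auto
    also have "\<dots> = (\<Prod>i\<in>I. emeasure (density (M i) (f i)) (A i))"
      using A by (intro prod.cong refl emeasure_density[symmetric]) auto
    finally show "emeasure (density (Pi\<^sub>M I M) (\<lambda>y. \<Prod>i\<in>I. f i (y i))) (Pi\<^sub>E I A)
      = (\<Prod>i\<in>I. emeasure (density (M i) (f i)) (A i))" .
  qed
qed

lemma measurable_case_prod_Complex [measurable]:
  "case_prod Complex \<in> borel_measurable (borel \<Otimes>\<^sub>M borel)"
  by (subst borel_measurable_complex_iff) (auto simp: case_prod_beta)

text \<open>Lebesgue measure is characterised by the volumes of boxes, and \<open>Complex\<close>
  pulls a box back to a product of two intervals. This carries joint densities of real and imaginary
  parts over to densities on the complex numbers.\<close>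

lemma lborel_complex: "(lborel :: complex measure) = distr (lborel \<Otimes>\<^sub>M lborel) borel (case_prod Complex)"
proof (rule lborel_eqI)
  fix l u :: complex
  assume le: "\<And>b. b \<in> Basis \<Longrightarrow> l \<bullet> b \<le> u \<bullet> b"
  have le': "Re l \<le> Re u" "Im l \<le> Im u"
    using le[of 1] le[of \<i>] by (auto simp: Basis_complex_def inner_complex_def)
  have "emeasure (distr (lborel \<Otimes>\<^sub>M lborel) borel (case_prod Complex)) (box l u)
    = emeasure (lborel \<Otimes>\<^sub>M lborel) (case_prod Complex -` box l u \<inter> space (lborel \<Otimes>\<^sub>M lborel))"
    by (intro emeasure_distr) auto
  also have "case_prod Complex -` box l u \<inter> space (lborel \<Otimes>\<^sub>M lborel)
      = {Re l<..<Re u} \<times> {Im l<..<Im u}"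
    by (auto simp: box_def Basis_complex_def inner_complex_def space_pair_measure)
  also have "emeasure (lborel \<Otimes>\<^sub>M lborel) \<dots> = ennreal (Re u - Re l) * ennreal (Im u - Im l)"
    using le' by (subst lborel.emeasure_pair_measure_Times) auto
  also have "\<dots> = (\<Prod>b\<in>Basis. (u - l) \<bullet> b)"
    using le' by (simp add: Basis_complex_def inner_complex_def ennreal_mult)
  finally show "emeasure (distr (lborel \<Otimes>\<^sub>M lborel) borel (case_prod Complex)) (box l u)
      = (\<Prod>b\<in>Basis. (u - l) \<bullet> b)" .
qed simp

text \<open>Independence makes the joint density of the two parts a product, and centred normal
  densities of equal variance multiply to a function of the modulus alone.\<close>

lemma circular_complex_gaussian_distr:
  assumes "prob_space \<Omega>" and N0: "N0 > 0" and X: "circular_complex_gaussian \<Omega> X (N0 / 2)"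
  shows "X \<in> borel_measurable \<Omega>"
    and "distr \<Omega> borel X = density lborel (\<lambda>z. ennreal (1 / (pi * N0) * exp (- (cmod z)\<^sup>2 / N0)))"
proof -
  interpret prob_space \<Omega> by fact
  let ?n = "\<lambda>x. ennreal (normal_density 0 (sqrt (N0 / 2)) x)"
  have ind: "indep_var borel (\<lambda>\<omega>. Re (X \<omega>)) borel (\<lambda>\<omega>. Im (X \<omega>))"
    and R: "distributed \<Omega> lborel (\<lambda>\<omega>. Re (X \<omega>)) ?n"
    and I: "distributed \<Omega> lborel (\<lambda>\<omega>. Im (X \<omega>)) ?n"
    using X by (auto simp: circular_complex_gaussian_def)
  have [measurable]: "(\<lambda>\<omega>. Re (X \<omega>)) \<in> borel_measurable \<Omega>" "(\<lambda>\<omega>. Im (X \<omega>)) \<in> borel_measurable \<Omega>"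
    using distributed_measurable[OF R] distributed_measurable[OF I] by auto
  show [measurable]: "X \<in> borel_measurable \<Omega>"
    by (subst borel_measurable_complex_iff) auto
  \<comment> \<open>Independence is phrased with \<open>borel\<close>, while
    \<open>distributed_joint_indep'\<close> wants the factorisation with \<open>lborel\<close>. The
    two agree because \<open>distr\<close> uses only the sigma-algebra of its target.\<close>
  have "distr \<Omega> lborel (\<lambda>\<omega>. Re (X \<omega>)) \<Otimes>\<^sub>M distr \<Omega> lborel (\<lambda>\<omega>. Im (X \<omega>))
      = distr \<Omega> borel (\<lambda>\<omega>. Re (X \<omega>)) \<Otimes>\<^sub>M distr \<Omega> borel (\<lambda>\<omega>. Im (X \<omega>))"
    by (intro arg_cong2[where f = pair_measure] distr_cong) auto
  also have "\<dots> = distr \<Omega> (borel \<Otimes>\<^sub>M borel) (\<lambda>\<omega>. (Re (X \<omega>), Im (X \<omega>)))"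
    using ind by (simp add: indep_var_distribution_eq)
  also have "\<dots> = distr \<Omega> (lborel \<Otimes>\<^sub>M lborel) (\<lambda>\<omega>. (Re (X \<omega>), Im (X \<omega>)))"
    by (intro distr_cong refl sets_pair_measure_cong) auto
  finally have joint: "distributed \<Omega> (lborel \<Otimes>\<^sub>M lborel) (\<lambda>\<omega>. (Re (X \<omega>), Im (X \<omega>)))
      (\<lambda>(x, y). ?n x * ?n y)"
    by (intro distributed_joint_indep' R I lborel.sigma_finite_measure_axioms)
  \<comment> \<open>With variance \<open>N0 / 2\<close>, each normal density has normalisation
    \<open>1 / sqrt (pi * N0)\<close> and exponent \<open>- x\<^sup>2 / N0\<close>.\<close>
  have dens: "?n x * ?n y = ennreal (1 / (pi * N0) * exp (- (cmod (Complex x y))\<^sup>2 / N0))" for x y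
  proof -
    have "normal_density 0 (sqrt (N0 / 2)) x * normal_density 0 (sqrt (N0 / 2)) y
       = 1 / (sqrt (pi * N0) * sqrt (pi * N0)) * (exp (- x\<^sup>2 / N0) * exp (- y\<^sup>2 / N0))"
      using N0 by (simp add: normal_density_def)
    also have "\<dots> = 1 / (pi * N0) * exp (- (cmod (Complex x y))\<^sup>2 / N0)"
      using N0 by (simp add: exp_add[symmetric] cmod_power2 add_divide_distrib diff_divide_distrib)
    finally show ?thesis by (simp add: ennreal_mult[symmetric])
  qed
  have "distr \<Omega> borel X
      = distr (distr \<Omega> (lborel \<Otimes>\<^sub>M lborel) (\<lambda>\<omega>. (Re (X \<omega>), Im (X \<omega>)))) borel (case_prod Complex)"
    by (subst distr_distr) (auto simp: comp_def)
  also have "distr \<Omega> (lborel \<Otimes>\<^sub>M lborel) (\<lambda>\<omega>. (Re (X \<omega>), Im (X \<omega>)))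
      = density (lborel \<Otimes>\<^sub>M lborel)
          (\<lambda>p. ennreal (1 / (pi * N0) * exp (- (cmod (case_prod Complex p))\<^sup>2 / N0)))"
    using distributed_distr_eq_density[OF joint] by (simp add: dens case_prod_beta')
  also have "distr \<dots> borel (case_prod Complex)
      = density lborel (\<lambda>z. ennreal (1 / (pi * N0) * exp (- (cmod z)\<^sup>2 / N0)))"
    by (subst lborel_complex, subst density_distr) auto
  finally show "distr \<Omega> borel X
      = density lborel (\<lambda>z. ennreal (1 / (pi * N0) * exp (- (cmod z)\<^sup>2 / N0)))" .
qed

lemma distr_add_const_density:
  fixes c :: "'b::euclidean_space"
  assumes [measurable]: "X \<in> borel_measurable \<Omega>" "f \<in> borel_measurable borel"
    and "distr \<Omega> borel X = density lborel f"
  shows "distr \<Omega> borel (\<lambda>\<omega>. c + X \<omega>) = density lborel (\<lambda>z. f (z - c))"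
proof -
  have "distr \<Omega> borel (\<lambda>\<omega>. c + X \<omega>) = distr (distr \<Omega> borel X) borel ((+) c)"
    by (subst distr_distr) (auto simp: comp_def)
  also have "\<dots> = distr (density lborel f) borel ((+) c)"
    using assms by simp
  also have "\<dots> = density (distr lborel borel ((+) c)) (\<lambda>z. f (z - c))"
    by (subst density_distr) auto
  finally show ?thesis by (simp add: lborel_distr_plus)
qed

text \<open>The density of a fixed mean vector in additive white Gaussian noise. The mean is
  arbitrary instead of an echo, since the chi-square computation uses the mean
  \<open>2 * \<mu>' k - \<mu> k\<close>, which need not come from any parameter.\<close>

definition awgn_density :: "'i set \<Rightarrow> real \<Rightarrow> ('i \<Rightarrow> complex) \<Rightarrow> ('i \<Rightarrow> complex) \<Rightarrow> real" where
  "awgn_density I N0 \<mu> y = (\<Prod>k\<in>I. 1 / (pi * N0) * exp (- (cmod (y k - \<mu> k))\<^sup>2 / N0))"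

lemma awgn_density_pos: "N0 > 0 \<Longrightarrow> awgn_density I N0 \<mu> y > 0"
  by (auto simp: awgn_density_def intro!: prod_pos)

lemma awgn_density_measurable [measurable]:
  "awgn_density I N0 \<mu> \<in> borel_measurable (Pi\<^sub>M I (\<lambda>_. lborel))"
proof -
  have *: "(\<lambda>y. cmod (y k - \<mu> k)) \<in> borel_measurable (Pi\<^sub>M I (\<lambda>_. lborel))" if "k \<in> I" for k
    using that by measurable
  show ?thesis
    unfolding awgn_density_def[abs_def]
    by (intro borel_measurable_prod borel_measurable_times borel_measurable_const
        measurable_compose[OF _ borel_measurable_exp] borel_measurable_divide borel_measurable_uminus
        borel_measurable_power *)
qed

text \<open>Independence turns the joint law into the product of the marginals, each of which is a
  translated complex Gaussian with a Lebesgue density; \<open>density_PiM\<close> then multiplies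
  these densities.\<close>

lemma distributed_awgn:
  fixes W :: "'i \<Rightarrow> 'a \<Rightarrow> complex"
  assumes "prob_space \<Omega>" and N0: "N0 > 0" and fin: "finite I" and ne: "I \<noteq> {}"
    and indep: "prob_space.indep_vars \<Omega> (\<lambda>_. borel) W I"
    and gauss: "\<And>k. k \<in> I \<Longrightarrow> circular_complex_gaussian \<Omega> (W k) (N0 / 2)"
  shows "distributed \<Omega> (Pi\<^sub>M I (\<lambda>_. lborel)) (\<lambda>\<omega>. \<lambda>k\<in>I. \<mu> k + W k \<omega>)
           (\<lambda>y. ennreal (awgn_density I N0 \<mu> y))"
proof -
  interpret prob_space \<Omega> by fact
  let ?f = "\<lambda>k z. ennreal (1 / (pi * N0) * exp (- (cmod (z - \<mu> k))\<^sup>2 / N0))"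
  have W [measurable]: "W k \<in> borel_measurable \<Omega>" if "k \<in> I" for k
    using circular_complex_gaussian_distr(1)[OF assms(1) N0 gauss[OF that]] .
  have marg: "distr \<Omega> borel (\<lambda>\<omega>. \<mu> k + W k \<omega>) = density lborel (?f k)" if "k \<in> I" for k
    by (rule distr_add_const_density[OF W[OF that] _
          circular_complex_gaussian_distr(2)[OF assms(1) N0 gauss[OF that]]]) simp
  have sets: "sets (Pi\<^sub>M I (\<lambda>_. lborel :: complex measure)) = sets (Pi\<^sub>M I (\<lambda>_. borel))"
    by (intro sets_PiM_cong) auto
  \<comment> \<open>This is needed for every \<open>k\<close>, also outside \<open>I\<close>, where
    nothing is known about \<open>W k\<close>. Any noise variable \<open>W j\<close> with
    \<open>j \<in> I\<close> has the right law, so shifting it by \<open>\<mu> k\<close> exhibits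
    the density as that of a probability measure.\<close>
  have sfd: "sigma_finite_measure (density lborel (?f k))" for k
  proof -
    obtain j where j: "j \<in> I" using ne by auto
    have "density lborel (?f k) = distr \<Omega> borel (\<lambda>\<omega>. \<mu> k + W j \<omega>)"
      by (rule distr_add_const_density[OF W[OF j] _
          circular_complex_gaussian_distr(2)[OF assms(1) N0 gauss[OF j]], symmetric]) simp
    moreover have "prob_space (distr \<Omega> borel (\<lambda>\<omega>. \<mu> k + W j \<omega>))"
      using W[OF j] by (intro prob_space_distr) simp
    ultimately show ?thesis
      by (simp add: prob_space_imp_sigma_finite)
  qed
  have "indep_vars (\<lambda>_. borel) (\<lambda>k \<omega>. \<mu> k + W k \<omega>) I"
    by (rule indep_vars_compose2[OF indep, of "\<lambda>k z. \<mu> k + z"]) simp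
  then have "distr \<Omega> (Pi\<^sub>M I (\<lambda>_. borel)) (\<lambda>\<omega>. \<lambda>k\<in>I. \<mu> k + W k \<omega>)
      = Pi\<^sub>M I (\<lambda>k. distr \<Omega> borel (\<lambda>\<omega>. \<mu> k + W k \<omega>))"
    by (subst (asm) indep_vars_iff_distr_eq_PiM'[OF ne]) auto
  also have "\<dots> = Pi\<^sub>M I (\<lambda>k. density lborel (?f k))"
    using marg by (intro PiM_cong) auto
  also have "\<dots> = density (Pi\<^sub>M I (\<lambda>_. lborel)) (\<lambda>y. \<Prod>k\<in>I. ?f k (y k))"
    by (intro density_PiM[symmetric] fin sfd lborel.sigma_finite_measure_axioms) simp
  also have "(\<lambda>y. \<Prod>k\<in>I. ?f k (y k)) = (\<lambda>y. ennreal (awgn_density I N0 \<mu> y))"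
    using N0 by (simp add: awgn_density_def prod_ennreal fun_eq_iff)
  also have "distr \<Omega> (Pi\<^sub>M I (\<lambda>_. borel)) (\<lambda>\<omega>. \<lambda>k\<in>I. \<mu> k + W k \<omega>)
      = distr \<Omega> (Pi\<^sub>M I (\<lambda>_. lborel)) (\<lambda>\<omega>. \<lambda>k\<in>I. \<mu> k + W k \<omega>)"
    using sets by (intro distr_cong) auto
  finally show ?thesis
    unfolding distributed_def
    by (auto intro!: measurable_restrict)
qed

section \<open>The Hammersley-Chapman-Robbins inequality for Gaussian shifts\<close>

text \<open>Cauchy-Schwarz for the factors \<open>\<bar>g x - f x\<bar> / sqrt (f x)\<close> and
  \<open>sqrt (f x) * \<bar>T x - a\<bar>\<close>: the first gives the chi-square divergence, the
  second the variance under \<open>f\<close>. Working in \<open>ennreal\<close> includes infinite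
  variance.\<close>

lemma hammersley_chapman_robbins:
  fixes f g T :: "'b \<Rightarrow> real"
  assumes [measurable]: "f \<in> borel_measurable M" "g \<in> borel_measurable M" "T \<in> borel_measurable M"
    and fpos: "\<And>x. f x > 0"
    and f: "integrable M f" "(\<integral>x. f x \<partial>M) = 1" and g: "integrable M g" "(\<integral>x. g x \<partial>M) = 1"
    and Tf: "integrable M (\<lambda>x. f x * T x)" and Tg: "integrable M (\<lambda>x. g x * T x)"
    and gf: "integrable M (\<lambda>x. (g x)\<^sup>2 / f x)"
  shows "ennreal (((\<integral>x. g x * T x \<partial>M) - (\<integral>x. f x * T x \<partial>M))\<^sup>2)
    \<le> ennreal ((\<integral>x. (g x)\<^sup>2 / f x \<partial>M) - 1)
        * (\<integral>\<^sup>+x. ennreal (f x) * ennreal ((T x - (\<integral>x. f x * T x \<partial>M))\<^sup>2) \<partial>M)"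
proof -
  define a where "a = (\<integral>x. f x * T x \<partial>M)"
  define b where "b = (\<integral>x. g x * T x \<partial>M)"
  have int: "integrable M (\<lambda>x. (g x - f x) * (T x - a))"
    using f g Tf Tg by (simp add: algebra_simps)
  \<comment> \<open>Since \<open>f\<close> and \<open>g\<close> have the same mass, centring
    \<open>T\<close> at \<open>a\<close> does not change the integral against
    \<open>g - f\<close>.\<close>
  have "(\<integral>x. (g x - f x) * (T x - a) \<partial>M) = (\<integral>x. g x * T x - f x * T x - a * g x + a * f x \<partial>M)"
    by (simp add: algebra_simps)
  also have "\<dots> = b - a"
    using f g Tf Tg by (simp add: a_def b_def)
  finally have "ennreal \<bar>b - a\<bar> \<le> (\<integral>\<^sup>+x. ennreal (norm ((g x - f x) * (T x - a))) \<partial>M)"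
    using integral_norm_bound_ennreal[OF int] by simp
  also have "\<dots> = (\<integral>\<^sup>+x. ennreal (\<bar>g x - f x\<bar> / sqrt (f x)) * ennreal (sqrt (f x) * \<bar>T x - a\<bar>) \<partial>M)"
    using fpos by (intro nn_integral_cong)
      (simp add: ennreal_mult[symmetric] abs_mult less_imp_le less_imp_neq[symmetric])
  finally have "(ennreal \<bar>b - a\<bar>)\<^sup>2
      \<le> (\<integral>\<^sup>+x. ennreal (\<bar>g x - f x\<bar> / sqrt (f x)) * ennreal (sqrt (f x) * \<bar>T x - a\<bar>) \<partial>M)\<^sup>2"
    by (rule power_mono) simp
  also have "\<dots> \<le> (\<integral>\<^sup>+x. (ennreal (\<bar>g x - f x\<bar> / sqrt (f x)))\<^sup>2 \<partial>M)
      * (\<integral>\<^sup>+x. (ennreal (sqrt (f x) * \<bar>T x - a\<bar>))\<^sup>2 \<partial>M)"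
    by (rule Cauchy_Schwarz_nn_integral) auto
  also have "(\<integral>\<^sup>+x. (ennreal (sqrt (f x) * \<bar>T x - a\<bar>))\<^sup>2 \<partial>M)
      = (\<integral>\<^sup>+x. ennreal (f x) * ennreal ((T x - a)\<^sup>2) \<partial>M)"
    using fpos by (intro nn_integral_cong)
      (simp add: ennreal_power ennreal_mult[symmetric] power_mult_distrib less_imp_le)
  also have "(\<integral>\<^sup>+x. (ennreal (\<bar>g x - f x\<bar> / sqrt (f x)))\<^sup>2 \<partial>M)
      = (\<integral>\<^sup>+x. ennreal ((g x)\<^sup>2 / f x - 2 * g x + f x) \<partial>M)"
  proof (intro nn_integral_cong)
    fix x
    have "(\<bar>g x - f x\<bar> / sqrt (f x))\<^sup>2 = (g x)\<^sup>2 / f x - 2 * g x + f x"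
      using fpos[of x] by (simp add: power_divide less_imp_le field_simps power2_eq_square)
    then show "(ennreal (\<bar>g x - f x\<bar> / sqrt (f x)))\<^sup>2 = ennreal ((g x)\<^sup>2 / f x - 2 * g x + f x)"
      using fpos[of x] by (simp add: ennreal_power less_imp_le)
  qed
  also have "\<dots> = ennreal (\<integral>x. (g x)\<^sup>2 / f x - 2 * g x + f x \<partial>M)"
  proof (intro nn_integral_eq_integral AE_I2)
    show "integrable M (\<lambda>x. (g x)\<^sup>2 / f x - 2 * g x + f x)"
      using f g gf by simp
    fix x
    have "(g x)\<^sup>2 / f x - 2 * g x + f x = (g x - f x)\<^sup>2 / f x"
      using fpos[of x] by (simp add: field_simps power2_eq_square)
    then show "0 \<le> (g x)\<^sup>2 / f x - 2 * g x + f x"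
      using fpos[of x] by simp
  qed
  also have "(\<integral>x. (g x)\<^sup>2 / f x - 2 * g x + f x \<partial>M) = (\<integral>x. (g x)\<^sup>2 / f x \<partial>M) - 1"
    using f g gf by simp
  also have "(ennreal \<bar>b - a\<bar>)\<^sup>2 = ennreal ((b - a)\<^sup>2)"
    by (simp add: ennreal_power)
  finally show ?thesis by (simp add: a_def b_def)
qed

lemma awgn_density_square_ratio:
  assumes N0: "N0 > 0" and fin: "finite I"
  shows "(awgn_density I N0 \<mu>' y)\<^sup>2 / awgn_density I N0 \<mu> y
    = exp (2 * (\<Sum>k\<in>I. (cmod (\<mu>' k - \<mu> k))\<^sup>2) / N0) * awgn_density I N0 (\<lambda>k. 2 * \<mu>' k - \<mu> k) y"
proof -
  let ?e = "\<lambda>\<mu> k. 1 / (pi * N0) * exp (- (cmod (y k - \<mu> k))\<^sup>2 / N0)"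
  have "(?e \<mu>' k)\<^sup>2 / ?e \<mu> k
      = exp (2 * (cmod (\<mu>' k - \<mu> k))\<^sup>2 / N0) * ?e (\<lambda>k. 2 * \<mu>' k - \<mu> k) k" for k
  proof -
    \<comment> \<open>The parallelogram law for \<open>y k - \<mu>' k\<close> and
      \<open>\<mu>' k - \<mu> k\<close>, whose sum is \<open>y k - \<mu> k\<close> and whose
      difference is \<open>y k - (2 * \<mu>' k - \<mu> k)\<close>.\<close>
    have "2 * (cmod (y k - \<mu>' k))\<^sup>2 - (cmod (y k - \<mu> k))\<^sup>2
        = (cmod (y k - (2 * \<mu>' k - \<mu> k)))\<^sup>2 - 2 * (cmod (\<mu>' k - \<mu> k))\<^sup>2"
      unfolding cmod_power2 by (simp add: power2_eq_square algebra_simps)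
    then have "- (2 * (cmod (y k - \<mu>' k))\<^sup>2) / N0 - - (cmod (y k - \<mu> k))\<^sup>2 / N0
        = 2 * (cmod (\<mu>' k - \<mu> k))\<^sup>2 / N0 + - (cmod (y k - (2 * \<mu>' k - \<mu> k)))\<^sup>2 / N0"
      using N0 by (simp add: field_simps)
    moreover have "(?e \<mu>' k)\<^sup>2 / ?e \<mu> k = 1 / (pi * N0)
        * exp (- (2 * (cmod (y k - \<mu>' k))\<^sup>2) / N0 - - (cmod (y k - \<mu> k))\<^sup>2 / N0)"
    proof -
      have "exp (- (2 * (cmod (y k - \<mu>' k))\<^sup>2) / N0) = (exp (- (cmod (y k - \<mu>' k))\<^sup>2 / N0))\<^sup>2"
        by (simp add: exp_double[symmetric])
      then show ?thesis
        using N0 by (simp only: exp_diff) (simp add: power2_eq_square)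
    qed
    ultimately show ?thesis
      by (metis exp_add mult.left_commute)
  qed
  then have "(\<Prod>k\<in>I. (?e \<mu>' k)\<^sup>2 / ?e \<mu> k)
      = (\<Prod>k\<in>I. exp (2 * (cmod (\<mu>' k - \<mu> k))\<^sup>2 / N0)) * awgn_density I N0 (\<lambda>k. 2 * \<mu>' k - \<mu> k) y"
    by (simp only: prod.distrib awgn_density_def)
  moreover have "(\<Prod>k\<in>I. exp (2 * (cmod (\<mu>' k - \<mu> k))\<^sup>2 / N0))
      = exp (2 * (\<Sum>k\<in>I. (cmod (\<mu>' k - \<mu> k))\<^sup>2) / N0)"
    using fin by (simp add: exp_sum[symmetric] sum_distrib_left sum_divide_distrib)
  moreover have "(\<Prod>k\<in>I. (?e \<mu>' k)\<^sup>2 / ?e \<mu> k) = (awgn_density I N0 \<mu>' y)\<^sup>2 / awgn_density I N0 \<mu> y"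
    by (simp only: prod_dividef prod_power_distrib awgn_density_def)
  ultimately show ?thesis by simp
qed

lemma awgn_chapman_robbins:
  fixes W :: "'i \<Rightarrow> 'a \<Rightarrow> complex"
  assumes "prob_space \<Omega>" and N0: "N0 > 0" and fin: "finite I" and ne: "I \<noteq> {}"
    and indep: "prob_space.indep_vars \<Omega> (\<lambda>_. borel) W I"
    and gauss: "\<And>k. k \<in> I \<Longrightarrow> circular_complex_gaussian \<Omega> (W k) (N0 / 2)"
  defines "Q \<equiv> \<lambda>\<mu>. distr \<Omega> (Pi\<^sub>M I (\<lambda>_. borel)) (\<lambda>\<omega>. \<lambda>k\<in>I. \<mu> k + W k \<omega>)"
  assumes T: "T \<in> borel_measurable (Pi\<^sub>M I (\<lambda>_. borel))"
    and int: "integrable (Q \<mu>) T" "integrable (Q \<mu>') T"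
  shows "ennreal (((\<integral>y. T y \<partial>Q \<mu>') - (\<integral>y. T y \<partial>Q \<mu>))\<^sup>2)
    \<le> ennreal (exp (2 * (\<Sum>k\<in>I. (cmod (\<mu>' k - \<mu> k))\<^sup>2) / N0) - 1) * estimator_variance (Q \<mu>) T"
proof -
  interpret prob_space \<Omega> by fact
  let ?L = "Pi\<^sub>M I (\<lambda>_. lborel :: complex measure)"
  let ?q = "awgn_density I N0"
  have sets: "sets ?L = sets (Pi\<^sub>M I (\<lambda>_. borel))"
    by (intro sets_PiM_cong) auto
  have [measurable]: "T \<in> borel_measurable ?L"
    using T measurable_cong_sets[OF sets refl] by blast
  note D = distributed_awgn[OF assms(1) N0 fin ne indep gauss]
  have Q: "Q \<nu> = density ?L (\<lambda>y. ennreal (?q \<nu> y))" for \<nu>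
  proof -
    have "Q \<nu> = distr \<Omega> ?L (\<lambda>\<omega>. \<lambda>k\<in>I. \<nu> k + W k \<omega>)"
      unfolding Q_def using sets by (intro distr_cong) auto
    then show ?thesis by (simp add: distributed_distr_eq_density[OF D])
  qed
  have pos: "?q \<nu> y > 0" for \<nu> y
    using awgn_density_pos[OF N0] .
  \<comment> \<open>The mass is one for every mean \<open>\<nu>\<close>, because the density belongs
    to a law induced from the probability space; no Gaussian integral has to be evaluated.\<close>
  have one: "integrable ?L (?q \<nu>)" "(\<integral>y. ?q \<nu> y \<partial>?L) = 1" for \<nu>
  proof -
    have "prob_space (density ?L (\<lambda>y. ennreal (?q \<nu> y)))"
      using prob_space_distr[OF distributed_measurable[OF D[of \<nu>]]]
      by (simp only: distributed_distr_eq_density[OF D])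
    then have "(\<integral>\<^sup>+y. ennreal (?q \<nu> y) \<partial>?L) = ennreal 1"
      using prob_space.emeasure_space_1 by (fastforce simp: emeasure_density)
    then show "integrable ?L (?q \<nu>)" "(\<integral>y. ?q \<nu> y \<partial>?L) = 1"
      using nn_integral_eq_integrable[of "?q \<nu>" ?L 1] pos[of \<nu>] by (auto simp: less_imp_le)
  qed
  have intQ: "integrable ?L (\<lambda>y. ?q \<nu> y * T y)" if "integrable (Q \<nu>) T" for \<nu>
    using that pos[of \<nu>] unfolding Q by (simp add: integrable_density less_imp_le)
  have EQ: "(\<integral>y. T y \<partial>Q \<nu>) = (\<integral>y. ?q \<nu> y * T y \<partial>?L)" for \<nu>
    using pos[of \<nu>] unfolding Q by (simp add: integral_density less_imp_le)
  note ratio = awgn_density_square_ratio[OF N0 fin]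
  have "ennreal (((\<integral>y. ?q \<mu>' y * T y \<partial>?L) - (\<integral>y. ?q \<mu> y * T y \<partial>?L))\<^sup>2)
    \<le> ennreal ((\<integral>y. (?q \<mu>' y)\<^sup>2 / ?q \<mu> y \<partial>?L) - 1)
       * (\<integral>\<^sup>+y. ennreal (?q \<mu> y) * ennreal ((T y - (\<integral>y. ?q \<mu> y * T y \<partial>?L))\<^sup>2) \<partial>?L)"
    \<comment> \<open>By \<open>ratio\<close>, the chi-square integrand is a constant times the
      density with the reflected mean, so \<open>one\<close> gives its integrability.\<close>
    by (rule hammersley_chapman_robbins) (simp_all add: pos one intQ int ratio)
  moreover have "(\<integral>\<^sup>+y. ennreal (?q \<mu> y) * ennreal ((T y - (\<integral>y. ?q \<mu> y * T y \<partial>?L))\<^sup>2) \<partial>?L)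
      = estimator_variance (Q \<mu>) T"
    unfolding estimator_variance_def EQ unfolding Q by (subst nn_integral_density) auto
  moreover have "(\<integral>y. (?q \<mu>' y)\<^sup>2 / ?q \<mu> y \<partial>?L)
      = exp (2 * (\<Sum>k\<in>I. (cmod (\<mu>' k - \<mu> k))\<^sup>2) / N0)"
    by (simp add: ratio one)
  ultimately show ?thesis
    by (simp add: EQ)
qed

text \<open>For finite \<open>V\<close>, divide by \<open>t\<^sup>2\<close> and use that
  \<open>(exp (c * t\<^sup>2) - 1) / t\<^sup>2\<close> tends to \<open>c\<close>; for infinite
  \<open>V\<close> the claim is trivial. The limit is one-sided, so only small positive
  \<open>t\<close> are required.\<close>

lemma chapman_robbins_limit:
  fixes c d e :: real and V :: ennreal
  assumes c: "c > 0" and e: "e > 0"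
    and bound: "\<And>t. 0 < t \<Longrightarrow> t < e \<Longrightarrow> ennreal ((t * d)\<^sup>2) \<le> ennreal (exp (c * t\<^sup>2) - 1) * V"
  shows "ennreal (d\<^sup>2 / c) \<le> V"
proof (cases V)
  case (real r)
  have "d\<^sup>2 \<le> c * r"
  proof (rule tendsto_lowerbound)
    have "((\<lambda>t. (exp (c * t\<^sup>2) - 1) / t\<^sup>2) \<longlongrightarrow> c) (at_right 0)"
      using c by real_asymp
    then show "((\<lambda>t. (exp (c * t\<^sup>2) - 1) / t\<^sup>2 * r) \<longlongrightarrow> c * r) (at_right 0)"
      by (rule tendsto_mult_right)
    have "d\<^sup>2 \<le> (exp (c * t\<^sup>2) - 1) / t\<^sup>2 * r" if t: "0 < t" "t < e" for t
    proof -
      have "0 \<le> exp (c * t\<^sup>2) - 1" using c by simp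
      then have "ennreal ((t * d)\<^sup>2) \<le> ennreal ((exp (c * t\<^sup>2) - 1) * r)"
        using bound[OF t] real by (simp add: ennreal_mult)
      then have "(t * d)\<^sup>2 \<le> (exp (c * t\<^sup>2) - 1) * r"
        using c real by (subst (asm) ennreal_le_iff) auto
      then show ?thesis using t by (simp add: field_simps power_mult_distrib)
    qed
    then show "\<forall>\<^sub>F t in at_right 0. d\<^sup>2 \<le> (exp (c * t\<^sup>2) - 1) / t\<^sup>2 * r"
      using e by (auto simp: eventually_at_right_field)
  qed simp
  then show ?thesis using c real by (simp add: field_simps)
qed simp

section \<open>Moments of the noise and the inverse of a 2x2 matrix\<close>

lemma (in prob_space) normal_zero_mean_moments:
  assumes s: "\<sigma> > 0" and X: "distributed M lborel X (\<lambda>x. ennreal (normal_density 0 \<sigma> x))"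
  shows "integrable M X" "expectation X = 0"
    and "integrable M (\<lambda>\<omega>. (X \<omega>)\<^sup>2)" "expectation (\<lambda>\<omega>. (X \<omega>)\<^sup>2) = \<sigma>\<^sup>2"
proof -
  show "integrable M X"
    using distributed_integrable[OF X, of "\<lambda>x. x"] integrable_normal_moment[OF s, of 0 1] by simp
  show E: "expectation X = 0"
    using normal_distributed_expectation[OF s X] by simp
  show "integrable M (\<lambda>\<omega>. (X \<omega>)\<^sup>2)"
    using distributed_integrable[OF X, of "\<lambda>x. x\<^sup>2"] integrable_normal_moment[OF s, of 0 2] by simp
  show "expectation (\<lambda>\<omega>. (X \<omega>)\<^sup>2) = \<sigma>\<^sup>2"
    using normal_distributed_variance[OF s X] E by simp
qed

text \<open>The cross term vanishes because the two parts are independent and centred. At the true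
  parameter every summand of the score is built from such a combination.\<close>

lemma circular_complex_gaussian_linear_moments:
  fixes a b :: real
  assumes "prob_space \<Omega>" and v: "v > 0" and X: "circular_complex_gaussian \<Omega> X v"
  defines "Z \<equiv> \<lambda>\<omega>. a * Re (X \<omega>) + b * Im (X \<omega>)"
  shows "integrable \<Omega> Z" "(\<integral>\<omega>. Z \<omega> \<partial>\<Omega>) = 0"
    and "integrable \<Omega> (\<lambda>\<omega>. (Z \<omega>)\<^sup>2)" "(\<integral>\<omega>. (Z \<omega>)\<^sup>2 \<partial>\<Omega>) = (a\<^sup>2 + b\<^sup>2) * v"
proof -
  interpret prob_space \<Omega> by fact
  have ind: "indep_var borel (\<lambda>\<omega>. Re (X \<omega>)) borel (\<lambda>\<omega>. Im (X \<omega>))"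
    using X by (auto simp: circular_complex_gaussian_def)
  have s: "sqrt v > 0" using v by simp
  note R = normal_zero_mean_moments[OF s, of "\<lambda>\<omega>. Re (X \<omega>)"]
    and I = normal_zero_mean_moments[OF s, of "\<lambda>\<omega>. Im (X \<omega>)"]
  have dist: "distributed \<Omega> lborel (\<lambda>\<omega>. Re (X \<omega>)) (\<lambda>x. ennreal (normal_density 0 (sqrt v) x))"
    "distributed \<Omega> lborel (\<lambda>\<omega>. Im (X \<omega>)) (\<lambda>x. ennreal (normal_density 0 (sqrt v) x))"
    using X by (auto simp: circular_complex_gaussian_def)
  note R = R[OF dist(1)] and I = I[OF dist(2)]
  have RI: "integrable \<Omega> (\<lambda>\<omega>. Re (X \<omega>) * Im (X \<omega>))" "(\<integral>\<omega>. Re (X \<omega>) * Im (X \<omega>) \<partial>\<Omega>) = 0"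
    using indep_var_integrable[OF ind R(1) I(1)] indep_var_lebesgue_integral[OF ind R(1) I(1)] R I
    by auto
  show "integrable \<Omega> Z" "(\<integral>\<omega>. Z \<omega> \<partial>\<Omega>) = 0"
    unfolding Z_def using R I by auto
  have Z2: "(\<lambda>\<omega>. (Z \<omega>)\<^sup>2) = (\<lambda>\<omega>. a\<^sup>2 * (Re (X \<omega>))\<^sup>2 + b\<^sup>2 * (Im (X \<omega>))\<^sup>2
      + 2 * a * b * (Re (X \<omega>) * Im (X \<omega>)))"
    by (simp add: Z_def fun_eq_iff power2_eq_square algebra_simps)
  show "integrable \<Omega> (\<lambda>\<omega>. (Z \<omega>)\<^sup>2)" "(\<integral>\<omega>. (Z \<omega>)\<^sup>2 \<partial>\<Omega>) = (a\<^sup>2 + b\<^sup>2) * v"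
    unfolding Z2 using R I RI v by (auto simp: distrib_right)
qed

text \<open>Independent centred variables are orthogonal, so only the diagonal of the double sum
  survives. With the score components as the two combinations, this yields an entry of the Fisher
  information.\<close>

lemma (in prob_space) expectation_indep_linear_combinations:
  fixes Z :: "'i \<Rightarrow> 'a \<Rightarrow> real"
  assumes fin: "finite I" and ind: "indep_vars (\<lambda>_. borel) Z I"
    and Z: "\<And>k. k \<in> I \<Longrightarrow> integrable M (Z k)" "\<And>k. k \<in> I \<Longrightarrow> expectation (Z k) = 0"
    and Z2: "\<And>k. k \<in> I \<Longrightarrow> integrable M (\<lambda>\<omega>. (Z k \<omega>)\<^sup>2)"
      "\<And>k. k \<in> I \<Longrightarrow> expectation (\<lambda>\<omega>. (Z k \<omega>)\<^sup>2) = s"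
  shows "expectation (\<lambda>\<omega>. (\<Sum>k\<in>I. c k * Z k \<omega>) * (\<Sum>k\<in>I. d k * Z k \<omega>)) = s * (\<Sum>k\<in>I. c k * d k)"
proof -
  have prod: "integrable M (\<lambda>\<omega>. Z k \<omega> * Z l \<omega>)
      \<and> expectation (\<lambda>\<omega>. Z k \<omega> * Z l \<omega>) = (if k = l then s else 0)" if "k \<in> I" "l \<in> I" for k l
  proof (cases "k = l")
    case True
    then show ?thesis using Z2[OF that(1)] by (simp add: power2_eq_square)
  next
    case False
    have "indep_vars (\<lambda>_. borel) Z {k, l}"
      using indep_vars_subset[OF ind] that by simp
    then show ?thesis
      using indep_vars_lebesgue_integral[of "{k, l}" Z] indep_vars_integrable[of "{k, l}" Z] False Z that
      by auto
  qed
  have "expectation (\<lambda>\<omega>. (\<Sum>k\<in>I. c k * Z k \<omega>) * (\<Sum>k\<in>I. d k * Z k \<omega>))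
      = expectation (\<lambda>\<omega>. \<Sum>k\<in>I. \<Sum>l\<in>I. c k * d l * (Z k \<omega> * Z l \<omega>))"
    by (simp add: sum_product algebra_simps)
  also have "\<dots> = (\<Sum>k\<in>I. \<Sum>l\<in>I. c k * d l * (if k = l then s else 0))"
    using prod by (simp add: Bochner_Integration.integral_sum)
  also have "\<dots> = s * (\<Sum>k\<in>I. c k * d k)"
    using fin by (simp add: if_distrib[of "(*) _"] sum_distrib_left mult.commute cong: if_cong)
  finally show ?thesis .
qed

lemma matrix_inv_2x2_entry:
  fixes F :: "real^2^2"
  assumes "det F \<noteq> 0"
  shows "matrix_inv F $ 1 $ 1 = F $ 2 $ 2 / det F"
proof -
  have "invertible F" using assms by (simp add: invertible_det_nz)
  then have "matrix_inv F ** F = mat 1"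
    unfolding matrix_inv_def invertible_def by (metis (mono_tags, lifting) someI_ex)
  then have "(matrix_inv F ** F) $ 1 $ 1 = 1" "(matrix_inv F ** F) $ 1 $ 2 = 0"
    by (auto simp: mat_def)
  then have *: "matrix_inv F $ 1 $ 1 * F $ 1 $ 1 + matrix_inv F $ 1 $ 2 * F $ 2 $ 1 = 1"
    "matrix_inv F $ 1 $ 1 * F $ 1 $ 2 + matrix_inv F $ 1 $ 2 * F $ 2 $ 2 = 0"
    by (auto simp: matrix_matrix_mult_def sum_2)
  \<comment> \<open>Cramer's rule: this combination of the two equations in \<open>*\<close>
    eliminates the entry \<open>matrix_inv F $ 1 $ 2\<close>.\<close>
  have "matrix_inv F $ 1 $ 1 * det F
      = (matrix_inv F $ 1 $ 1 * F $ 1 $ 1 + matrix_inv F $ 1 $ 2 * F $ 2 $ 1) * F $ 2 $ 2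
        - (matrix_inv F $ 1 $ 1 * F $ 1 $ 2 + matrix_inv F $ 1 $ 2 * F $ 2 $ 2) * F $ 2 $ 1"
    by (simp add: det_2 algebra_simps)
  also have "\<dots> = F $ 2 $ 2"
    by (simp only: * mult_1 mult_zero_left diff_zero)
  finally show ?thesis using assms by (simp add: field_simps)
qed

section \<open>The echo as a function of its phase\<close>

text \<open>Delay and phase offset enter an echo only through this number. Its linearity in \<theta>
  lets the same function express phase values, phase increments and partial derivatives.\<close>

definition echo_phase :: "real \<Rightarrow> real^2 \<Rightarrow> nat \<Rightarrow> real" where
  "echo_phase \<Delta>f \<theta> i = 2 * pi * real i * \<Delta>f * \<theta> $ 1 - \<theta> $ 2"

lemma echo_eq: "echo A \<Delta>f \<theta> i = of_real A * cis (- echo_phase \<Delta>f \<theta> i)"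
  by (simp add: echo_def echo_phase_def cis_conv_exp algebra_simps)

text \<open>A chord of the circle of radius \<open>\<bar>A\<bar>\<close> is at most as long as its
  arc. An upper bound is enough, since the divergence increases with the distance of the
  means.\<close>

lemma cmod_echo_diff_le:
  "(cmod (echo A \<Delta>f \<theta>' i - echo A \<Delta>f \<theta> i))\<^sup>2 \<le> A\<^sup>2 * (echo_phase \<Delta>f (\<theta>' - \<theta>) i)\<^sup>2"
proof -
  let ?b = "echo_phase \<Delta>f \<theta> i" and ?d = "echo_phase \<Delta>f (\<theta>' - \<theta>) i"
  have "echo_phase \<Delta>f \<theta>' i = ?b + ?d"
    by (simp add: echo_phase_def algebra_simps)
  then have "echo A \<Delta>f \<theta>' i - echo A \<Delta>f \<theta> i
      = of_real A * cis (- ?b) * (exp (\<i> * of_real (- ?d)) - 1)"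
    by (simp add: echo_eq cis_conv_exp exp_add[symmetric] algebra_simps)
  then have "cmod (echo A \<Delta>f \<theta>' i - echo A \<Delta>f \<theta> i) = \<bar>A\<bar> * (2 * \<bar>sin (- ?d / 2)\<bar>)"
    by (simp only: norm_mult norm_of_real norm_cis dist_exp_i_1 mult_1_right)
  also have "\<dots> \<le> \<bar>A\<bar> * \<bar>?d\<bar>"
    using abs_sin_x_le_abs_x[of "- ?d / 2"] by (intro mult_left_mono) auto
  finally have "(cmod (echo A \<Delta>f \<theta>' i - echo A \<Delta>f \<theta> i))\<^sup>2 \<le> (\<bar>A\<bar> * \<bar>?d\<bar>)\<^sup>2"
    by (rule power_mono) simp
  then show ?thesis by (simp add: power_mult_distrib)
qed

section \<open>Score and Fisher information of the observations\<close>

lemma likelihood_eq_awgn_density: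
  "likelihood I A \<Delta>f N0 \<theta> y = awgn_density I N0 (\<lambda>(m, i). echo A \<Delta>f \<theta> i) y"
  by (simp add: likelihood_def awgn_density_def case_prod_beta')

lemma observation_eq_shift:
  "observation I A \<Delta>f W \<theta> = (\<lambda>\<omega>. \<lambda>k\<in>I. (\<lambda>(m, i). echo A \<Delta>f \<theta> i) k + (\<lambda>(m, i). W m i) k \<omega>)"
  by (auto simp: observation_def fun_eq_iff restrict_def)

text \<open>The phase is linear in the parameter, so \<open>echo_phase \<Delta>f (axis a 1) i\<close> is its partial derivative
  in the direction \<open>a\<close>.\<close>

lemma score_likelihood:
  assumes N0: "N0 > 0" and fin: "finite I"
  shows "score (likelihood I A \<Delta>f N0) \<theta> a y
    = (\<Sum>k\<in>I. echo_phase \<Delta>f (axis a 1) (snd k) * (- (2 * A / N0)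
        * (Re (y k) * sin (echo_phase \<Delta>f \<theta> (snd k)) + Im (y k) * cos (echo_phase \<Delta>f \<theta> (snd k)))))"
proof -
  let ?b = "\<lambda>t k. echo_phase \<Delta>f \<theta> (snd k) + t * echo_phase \<Delta>f (axis a 1) (snd k)"
  have phase: "echo_phase \<Delta>f (\<theta> + t *\<^sub>R axis a 1) (snd k) = ?b t k" for t k
    by (simp add: echo_phase_def algebra_simps)
  \<comment> \<open>The echo has constant modulus, so the phase affects only the inner product of
    observation and echo; the squared norms are constant in \<open>t\<close>.\<close>
  have sq: "(cmod (y k - echo A \<Delta>f (\<theta> + t *\<^sub>R axis a 1) (snd k)))\<^sup>2
      = (cmod (y k))\<^sup>2 + A\<^sup>2 - 2 * A * (Re (y k) * cos (?b t k) - Im (y k) * sin (?b t k))" for t k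
  proof -
    have "(cmod (y k - echo A \<Delta>f (\<theta> + t *\<^sub>R axis a 1) (snd k)))\<^sup>2
        = (Re (y k) - A * cos (?b t k))\<^sup>2 + (Im (y k) + A * sin (?b t k))\<^sup>2"
      by (simp add: echo_eq phase cmod_power2 del: minus_add_distrib)
    also have "\<dots> = (cmod (y k))\<^sup>2 + A\<^sup>2 * ((sin (?b t k))\<^sup>2 + (cos (?b t k))\<^sup>2)
        - 2 * A * (Re (y k) * cos (?b t k) - Im (y k) * sin (?b t k))"
      unfolding cmod_power2 by algebra
    finally show ?thesis by simp
  qed
  have ln_factor: "ln (1 / (pi * N0) * exp (- q / N0)) = ln (1 / (pi * N0)) - q / N0" for q
    using N0 by (subst ln_mult) auto
  have "ln (likelihood I A \<Delta>f N0 (\<theta> + t *\<^sub>R axis a 1) y)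
      = (\<Sum>k\<in>I. ln (1 / (pi * N0)) - ((cmod (y k))\<^sup>2 + A\<^sup>2
          - 2 * A * (Re (y k) * cos (?b t k) - Im (y k) * sin (?b t k))) / N0)" for t
    unfolding likelihood_eq_awgn_density awgn_density_def case_prod_beta' sq
    using N0 fin by (subst ln_prod) (simp_all only: ln_factor, auto)
  moreover have "((\<lambda>t. \<Sum>k\<in>I. ln (1 / (pi * N0)) - ((cmod (y k))\<^sup>2 + A\<^sup>2
          - 2 * A * (Re (y k) * cos (?b t k) - Im (y k) * sin (?b t k))) / N0)
      has_real_derivative (\<Sum>k\<in>I. echo_phase \<Delta>f (axis a 1) (snd k) * (- (2 * A / N0)
        * (Re (y k) * sin (echo_phase \<Delta>f \<theta> (snd k)) + Im (y k) * cos (echo_phase \<Delta>f \<theta> (snd k)))))) (at 0)"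
    using N0 by (auto intro!: derivative_eq_intros sum.cong simp: field_simps)
  ultimately show ?thesis
    unfolding score_def by (simp add: DERIV_imp_deriv)
qed

text \<open>At the true parameter the score is linear in the noise: by the chain rule, each sample
  contributes its phase derivative times a centred variable of variance
  \<open>2 * A\<^sup>2 / N0\<close>. The information is therefore a multiple of the Gram matrix of
  the phase derivatives.\<close>

lemma fisher_information_observation:
  fixes W :: "nat \<Rightarrow> nat \<Rightarrow> 'a \<Rightarrow> complex"
  assumes "prob_space \<Omega>" and N0: "N0 > 0" and fin: "finite I"
    and indep: "prob_space.indep_vars \<Omega> (\<lambda>_. borel) (\<lambda>(m, i). W m i) I"
    and gauss: "\<And>m i. (m, i) \<in> I \<Longrightarrow> circular_complex_gaussian \<Omega> (W m i) (N0 / 2)"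
  shows "fisher_information (observation_law \<Omega> I A \<Delta>f W) (likelihood I A \<Delta>f N0) \<theta> $ a $ b
    = 2 * A\<^sup>2 / N0 * (\<Sum>k\<in>I. echo_phase \<Delta>f (axis a 1) (snd k) * echo_phase \<Delta>f (axis b 1) (snd k))"
proof -
  interpret prob_space \<Omega> by fact
  let ?W = "\<lambda>(m, i). W m i"
  let ?s = "\<lambda>k. sin (echo_phase \<Delta>f \<theta> (snd k))" and ?c = "\<lambda>k. cos (echo_phase \<Delta>f \<theta> (snd k))"
  let ?C = "\<lambda>a k. echo_phase \<Delta>f (axis a 1) (snd k)"
  \<comment> \<open>\<open>Z k\<close> is the derivative of the log-density of sample
    \<open>k\<close> with respect to its phase, evaluated at the true parameter.\<close>
  define Z where "Z k \<omega> = (- (2 * A / N0) * ?s k) * Re (?W k \<omega>) + (- (2 * A / N0) * ?c k) * Im (?W k \<omega>)"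
    for k \<omega>
  have gauss': "circular_complex_gaussian \<Omega> (?W k) (N0 / 2)" if "k \<in> I" for k
    using gauss that by (cases k) auto
  have Wm [measurable]: "?W k \<in> borel_measurable \<Omega>" if "k \<in> I" for k
    using circular_complex_gaussian_distr(1)[OF assms(1) N0 gauss'[OF that]] .
  have v: "N0 / 2 > 0" using N0 by simp
  have s: "((- (2 * A / N0) * ?s k)\<^sup>2 + (- (2 * A / N0) * ?c k)\<^sup>2) * (N0 / 2) = 2 * A\<^sup>2 / N0" for k
  proof -
    have "((- (2 * A / N0) * ?s k)\<^sup>2 + (- (2 * A / N0) * ?c k)\<^sup>2) * (N0 / 2)
        = (2 * A / N0)\<^sup>2 * ((?s k)\<^sup>2 + (?c k)\<^sup>2) * (N0 / 2)"
      by (simp only: power_mult_distrib power2_minus distrib_left)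
    then show ?thesis using N0 by (simp add: power2_eq_square field_simps)
  qed
  have mom: "integrable \<Omega> (Z k)" "expectation (Z k) = 0"
      "integrable \<Omega> (\<lambda>\<omega>. (Z k \<omega>)\<^sup>2)" "expectation (\<lambda>\<omega>. (Z k \<omega>)\<^sup>2) = 2 * A\<^sup>2 / N0"
    if "k \<in> I" for k
    unfolding Z_def[abs_def] s[of k, symmetric]
    by (rule circular_complex_gaussian_linear_moments[OF assms(1) v gauss'[OF that]])+
  have "indep_vars (\<lambda>_. borel)
      (\<lambda>k \<omega>. (- (2 * A / N0) * ?s k) * Re (?W k \<omega>) + (- (2 * A / N0) * ?c k) * Im (?W k \<omega>)) I"
    by (rule indep_vars_compose2[OF indep,
          of "\<lambda>k z. (- (2 * A / N0) * ?s k) * Re z + (- (2 * A / N0) * ?c k) * Im z"]) simp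
  then have ind: "indep_vars (\<lambda>_. borel) Z I"
    by (simp add: Z_def[abs_def])
  have score: "score (likelihood I A \<Delta>f N0) \<theta> a (observation I A \<Delta>f W \<theta> \<omega>) = (\<Sum>k\<in>I. ?C a k * Z k \<omega>)"
    for a \<omega>
  proof -
    \<comment> \<open>The deterministic part cancels: an echo with phase \<open>b\<close> has real
      part \<open>A * cos b\<close> and imaginary part \<open>- A * sin b\<close>, so it contributes
      \<open>A * cos b * sin b - A * sin b * cos b = 0\<close>.\<close>
    have "- (2 * A / N0) * (Re (observation I A \<Delta>f W \<theta> \<omega> k) * ?s k
        + Im (observation I A \<Delta>f W \<theta> \<omega> k) * ?c k) = Z k \<omega>" if "k \<in> I" for k
      using that by (simp add: observation_def echo_eq Z_def case_prod_beta algebra_simps)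
    then show ?thesis
      unfolding score_likelihood[OF N0 fin] by (intro sum.cong) auto
  qed
  have meas: "observation I A \<Delta>f W \<theta> \<in> measurable \<Omega> (observation_space I)"
    unfolding observation_eq_shift using Wm by (intro measurable_restrict) simp
  have [measurable]: "score (likelihood I A \<Delta>f N0) \<theta> a \<in> borel_measurable (observation_space I)" for a
    unfolding score_likelihood[OF N0 fin, abs_def] by measurable
  have "fisher_information (observation_law \<Omega> I A \<Delta>f W) (likelihood I A \<Delta>f N0) \<theta> $ a $ b
      = (\<integral>\<omega>. (\<Sum>k\<in>I. ?C a k * Z k \<omega>) * (\<Sum>k\<in>I. ?C b k * Z k \<omega>) \<partial>\<Omega>)"
    unfolding fisher_information_def observation_law_def
    by (simp add: integral_distr[OF meas] score)
  also have "\<dots> = 2 * A\<^sup>2 / N0 * (\<Sum>k\<in>I. ?C a k * ?C b k)"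
    by (rule expectation_indep_linear_combinations[OF fin ind]) (use mom in auto)
  finally show ?thesis .
qed

section \<open>The variance bound for the delay\<close>

text \<open>The usual formula for a sum of squared deviations from the mean, cleared of
  denominators. It gives the sign of the determinant factor and the size of the phase change along
  the optimal direction.\<close>

lemma weighted_variance_identity:
  fixes a :: "'i \<Rightarrow> real"
  shows "(\<Sum>k\<in>I. (a k * real (card I) - (\<Sum>j\<in>I. a j))\<^sup>2)
    = real (card I) * (real (card I) * (\<Sum>k\<in>I. (a k)\<^sup>2) - (\<Sum>k\<in>I. a k)\<^sup>2)"
proof -
  let ?K = "real (card I)" and ?s = "\<Sum>j\<in>I. a j"
  have "(\<Sum>k\<in>I. (a k * ?K - ?s)\<^sup>2) = (\<Sum>k\<in>I. ?K\<^sup>2 * (a k)\<^sup>2 - 2 * ?K * ?s * a k + ?s\<^sup>2)"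
    by (intro sum.cong) (auto simp: power2_eq_square algebra_simps)
  also have "\<dots> = ?K\<^sup>2 * (\<Sum>k\<in>I. (a k)\<^sup>2) - 2 * ?K * ?s * ?s + ?K * ?s\<^sup>2"
    by (simp add: sum.distrib sum_subtractf sum_distrib_left)
  finally show ?thesis by (simp add: power2_eq_square algebra_simps)
qed

theorem mainTheorem1:
  fixes M N :: nat and S :: "nat \<Rightarrow> nat set" and \<Delta>f A N0 :: real
    and \<Omega> :: "'a measure" and W :: "nat \<Rightarrow> nat \<Rightarrow> 'a \<Rightarrow> complex"
    and \<Theta> :: "(real^2) set"
  defines "I \<equiv> sensing_indices M S"
  defines "P \<equiv> observation_law \<Omega> I A \<Delta>f W"
    and "p \<equiv> likelihood I A \<Delta>f N0"
    and "K \<equiv> (\<Sum>m<M. real (card (S m)))"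
    and "g1 \<equiv> (\<Sum>m<M. \<Sum>i\<in>S m. (2 * pi * \<Delta>f * real i)\<^sup>2)"
    and "g2 \<equiv> (\<Sum>m<M. \<Sum>i\<in>S m. 2 * pi * \<Delta>f * real i)\<^sup>2"
  assumes "M \<ge> 1" and "N \<ge> 1" and "\<And>m. m < M \<Longrightarrow> S m \<subseteq> {..<N}"
    and "\<Delta>f > 0" and "A > 0" and "N0 > 0"
    and "prob_space \<Omega>"
    and "prob_space.indep_vars \<Omega> (\<lambda>_. borel) (\<lambda>(m, i). W m i) I"
    and "\<And>m i. (m, i) \<in> I \<Longrightarrow> circular_complex_gaussian \<Omega> (W m i) (N0 / 2)"
    and "open \<Theta>" and "\<Theta> \<noteq> {}"
    and "K * g1 - g2 \<noteq> 0"
  shows "(\<forall>\<theta>\<in>\<Theta>.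
            distributed \<Omega> (Pi\<^sub>M I (\<lambda>_. lborel)) (observation I A \<Delta>f W \<theta>) (\<lambda>y. ennreal (p \<theta> y)) \<and>
            invertible (fisher_information P p \<theta>) \<and>
            cramer_rao_bound P p \<theta> 1 = N0 / (2 * A\<^sup>2) * (K / (K * g1 - g2))) \<and>
         (\<forall>T. unbiased_estimator (observation_space I) P \<Theta> 1 T \<longrightarrow>
            (\<forall>\<theta>\<in>\<Theta>. estimator_variance (P \<theta>) T \<ge>
               ennreal (N0 / (2 * A\<^sup>2) * (K / (K * g1 - g2))))) \<and>
         ((\<forall>m<M. S m = S 0) \<longrightarrow>
          (\<forall>T. unbiased_estimator (observation_space I) P \<Theta> 1 T \<longrightarrow>
            (\<forall>\<theta>\<in>\<Theta>. estimator_variance (P \<theta>) T \<ge>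
               ennreal (N0 / (2 * real M * A\<^sup>2) *
                 (real (card (S 0)) /
                   (real (card (S 0)) * (\<Sum>i\<in>S 0. (2 * pi * \<Delta>f * real i)\<^sup>2)
                     - (\<Sum>i\<in>S 0. 2 * pi * \<Delta>f * real i)\<^sup>2))))))"
proof -
  note A = \<open>A > 0\<close> and N0 = \<open>N0 > 0\<close> and prob = \<open>prob_space \<Omega>\<close>
    and indep = \<open>prob_space.indep_vars \<Omega> (\<lambda>_. borel) (\<lambda>(m, i). W m i) I\<close>
  have gauss: "circular_complex_gaussian \<Omega> ((\<lambda>(m, i). W m i) k) (N0 / 2)" if "k \<in> I" for k
    using assms(15) that by (cases k) auto
  define \<alpha> where "\<alpha> k = 2 * pi * \<Delta>f * real (snd k)" for k :: "nat \<times> nat"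
  define D where "D = K * g1 - g2"
  have finS: "finite (S m)" if "m < M" for m
    using assms(9)[OF that] finite_subset by blast
  have fin: "finite I"
    unfolding I_def sensing_indices_def using finS by auto
  have sumI: "(\<Sum>m<M. \<Sum>i\<in>S m. f (m, i)) = (\<Sum>k\<in>I. f k)" for f :: "nat \<times> nat \<Rightarrow> real"
    unfolding I_def sensing_indices_def using finS by (subst sum.Sigma) auto
  have K: "K = real (card I)"
    using sumI[of "\<lambda>_. 1"] by (simp add: K_def)
  have g1: "g1 = (\<Sum>k\<in>I. (\<alpha> k)\<^sup>2)" and g2: "g2 = (\<Sum>k\<in>I. \<alpha> k)\<^sup>2"
    using sumI[of "\<lambda>k. (\<alpha> k)\<^sup>2"] sumI[of \<alpha>] by (simp_all add: \<alpha>_def g1_def g2_def)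
  have D0: "D \<noteq> 0" using assms(18) by (simp add: D_def)
  \<comment> \<open>For empty \<open>I\<close> all of \<open>K\<close>, \<open>g1\<close> and
    \<open>g2\<close> vanish, contradicting \<open>D \<noteq> 0\<close>.\<close>
  have ne: "I \<noteq> {}"
    using D0 unfolding D_def K g1 g2 by auto
  have K0: "K > 0" using ne fin by (simp add: K card_gt_0_iff)
  have KD: "(\<Sum>k\<in>I. (\<alpha> k * K - (\<Sum>j\<in>I. \<alpha> j))\<^sup>2) = K * D"
    unfolding D_def K g1 g2 by (rule weighted_variance_identity)
  \<comment> \<open>The hypothesis only excludes zero; the sum of squares in \<open>KD\<close>
    supplies the sign.\<close>
  have Dpos: "D > 0"
  proof -
    have "0 \<le> K * D" unfolding KD[symmetric] by (intro sum_nonneg) auto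
    then show ?thesis using K0 D0 by (simp add: zero_le_mult_iff)
  qed
  have dist: "distributed \<Omega> (Pi\<^sub>M I (\<lambda>_. lborel)) (observation I A \<Delta>f W \<theta>) (\<lambda>y. ennreal (p \<theta> y))" for \<theta>
    unfolding observation_eq_shift p_def likelihood_eq_awgn_density
    by (rule distributed_awgn[OF prob N0 fin ne indep gauss])
  \<comment> \<open>The offset \<phi> enters the phase with a minus sign, which makes the
    off-diagonal entries of the information matrix negative.\<close>
  have C: "echo_phase \<Delta>f (axis 1 1) (snd k) = \<alpha> k" "echo_phase \<Delta>f (axis 2 1) (snd k) = - 1"
    for k :: "nat \<times> nat"
    by (simp_all add: echo_phase_def \<alpha>_def axis_def)
  let ?F = "\<lambda>\<theta>. fisher_information P p \<theta>"
  have fisher: "?F \<theta> $ a $ b = 2 * A\<^sup>2 / N0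
      * (\<Sum>k\<in>I. echo_phase \<Delta>f (axis a 1) (snd k) * echo_phase \<Delta>f (axis b 1) (snd k))" for \<theta> a b
    unfolding P_def p_def by (rule fisher_information_observation[OF prob N0 fin indep assms(15)])
  have F: "?F \<theta> $ 1 $ 1 = 2 * A\<^sup>2 / N0 * g1" "?F \<theta> $ 1 $ 2 = - (2 * A\<^sup>2 / N0 * (\<Sum>k\<in>I. \<alpha> k))"
    "?F \<theta> $ 2 $ 1 = - (2 * A\<^sup>2 / N0 * (\<Sum>k\<in>I. \<alpha> k))" "?F \<theta> $ 2 $ 2 = 2 * A\<^sup>2 / N0 * K" for \<theta>
    unfolding fisher C
    by (simp_all add: g1 K sum_negf power2_eq_square)
  have det: "det (?F \<theta>) = (2 * A\<^sup>2 / N0)\<^sup>2 * D" for \<theta>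
    unfolding det_2 F D_def g2 using N0 by (simp add: power2_eq_square field_simps)
  have det0: "det (?F \<theta>) \<noteq> 0" for \<theta>
    unfolding det using A N0 D0 by simp
  have inv: "invertible (?F \<theta>)" for \<theta>
    using det0 by (simp add: invertible_det_nz)
  have crb: "cramer_rao_bound P p \<theta> 1 = N0 / (2 * A\<^sup>2) * (K / D)" for \<theta>
    unfolding cramer_rao_bound_def matrix_inv_2x2_entry[OF det0] det F
    using A N0 D0 by (simp add: power2_eq_square field_simps)
  have bound: "ennreal (N0 / (2 * A\<^sup>2) * (K / D)) \<le> estimator_variance (P \<theta>) T"
    if T: "unbiased_estimator (observation_space I) P \<Theta> 1 T" and \<theta>: "\<theta> \<in> \<Theta>" for T \<theta>
  proof -
    \<comment> \<open>The direction that maximizes the squared change of the delay relative to the Fisher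
      quadratic form: up to scaling it is the first column of the inverse information matrix.\<close>
    define v :: "real^2" where "v = vector [K, \<Sum>k\<in>I. \<alpha> k]"
    have v: "v $ 1 = K" "v $ 2 = (\<Sum>k\<in>I. \<alpha> k)"
      by (simp_all add: v_def)
    obtain e where e: "e > 0" "ball \<theta> e \<subseteq> \<Theta>"
      using \<open>open \<Theta>\<close> \<theta> by (auto simp: open_contains_ball)
    \<comment> \<open>The radius \<open>?e\<close> keeps \<open>\<theta> + t *\<^sub>R v\<close>
      inside the ball; adding 1 keeps the denominator positive. The constant \<open>?c\<close> is
      the Fisher quadratic form at \<open>v\<close>.\<close>
    let ?e = "e / (norm v + 1)" and ?c = "2 * A\<^sup>2 / N0 * (K * D)"
    have Pd: "P \<theta> = distr \<Omega> (Pi\<^sub>M I (\<lambda>_. borel))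
        (\<lambda>\<omega>. \<lambda>k\<in>I. (\<lambda>(m, i). echo A \<Delta>f \<theta> i) k + (\<lambda>(m, i). W m i) k \<omega>)" for \<theta>
      by (simp only: P_def observation_law_def observation_eq_shift)
    have "ennreal (K\<^sup>2 / ?c) \<le> estimator_variance (P \<theta>) T"
    proof (rule chapman_robbins_limit)
      show "?c > 0" using A N0 K0 Dpos by simp
      show "?e > 0" using e by (simp add: add_nonneg_pos)
      fix t assume t: "0 < t" "t < ?e"
      let ?\<theta>' = "\<theta> + t *\<^sub>R v"
      have "t * norm v \<le> t * (norm v + 1)" using t by simp
      also have "\<dots> < e" using t(2) norm_ge_zero[of v] by (subst (asm) pos_less_divide_eq) linarith+
      finally have \<theta>': "?\<theta>' \<in> \<Theta>"
        using e t by (auto simp: dist_norm)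
      have "(\<Sum>k\<in>I. (cmod ((\<lambda>(m, i). echo A \<Delta>f ?\<theta>' i) k - (\<lambda>(m, i). echo A \<Delta>f \<theta> i) k))\<^sup>2)
          \<le> (\<Sum>k\<in>I. A\<^sup>2 * (echo_phase \<Delta>f (t *\<^sub>R v) (snd k))\<^sup>2)"
        using cmod_echo_diff_le[of A \<Delta>f ?\<theta>' _ \<theta>] by (intro sum_mono) (auto simp: case_prod_beta)
      also have "\<dots> = (\<Sum>k\<in>I. A\<^sup>2 * t\<^sup>2 * (\<alpha> k * K - (\<Sum>j\<in>I. \<alpha> j))\<^sup>2)"
      proof (intro sum.cong refl)
        fix k :: "nat \<times> nat"
        have "echo_phase \<Delta>f (t *\<^sub>R v) (snd k) = 2 * pi * real (snd k) * \<Delta>f * (t * K) - t * (\<Sum>j\<in>I. \<alpha> j)"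
          by (simp add: echo_phase_def v)
        also have "\<dots> = t * (\<alpha> k * K - (\<Sum>j\<in>I. \<alpha> j))"
          unfolding right_diff_distrib by (simp add: \<alpha>_def[of k])
        finally show "A\<^sup>2 * (echo_phase \<Delta>f (t *\<^sub>R v) (snd k))\<^sup>2
            = A\<^sup>2 * t\<^sup>2 * (\<alpha> k * K - (\<Sum>j\<in>I. \<alpha> j))\<^sup>2"
          by (simp only: power_mult_distrib mult.assoc)
      qed
      also have "\<dots> = A\<^sup>2 * t\<^sup>2 * (K * D)"
        by (simp add: sum_distrib_left[symmetric] KD)
      finally have "2 * (\<Sum>k\<in>I. (cmod ((\<lambda>(m, i). echo A \<Delta>f ?\<theta>' i) k
          - (\<lambda>(m, i). echo A \<Delta>f \<theta> i) k))\<^sup>2) / N0 \<le> 2 * (A\<^sup>2 * t\<^sup>2 * (K * D)) / N0"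
        using N0 by (intro divide_right_mono mult_left_mono) auto
      also have "\<dots> = ?c * t\<^sup>2" by simp
      finally have le: "2 * (\<Sum>k\<in>I. (cmod ((\<lambda>(m, i). echo A \<Delta>f ?\<theta>' i) k
          - (\<lambda>(m, i). echo A \<Delta>f \<theta> i) k))\<^sup>2) / N0 \<le> ?c * t\<^sup>2" .
      \<comment> \<open>Unbiasedness at both parameters turns the difference of means into the
        change of the delay, \<open>t * v $ 1\<close>.\<close>
      have E: "(\<integral>y. T y \<partial>P ?\<theta>') - (\<integral>y. T y \<partial>P \<theta>) = t * K"
        using T \<theta> \<theta>' by (simp add: unbiased_estimator_def v)
      have "ennreal (((\<integral>y. T y \<partial>P ?\<theta>') - (\<integral>y. T y \<partial>P \<theta>))\<^sup>2)
          \<le> ennreal (exp (2 * (\<Sum>k\<in>I. (cmod ((\<lambda>(m, i). echo A \<Delta>f ?\<theta>' i) k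
              - (\<lambda>(m, i). echo A \<Delta>f \<theta> i) k))\<^sup>2) / N0) - 1) * estimator_variance (P \<theta>) T"
        using T \<theta> \<theta>' unfolding Pd unbiased_estimator_def
        by (intro awgn_chapman_robbins[OF prob N0 fin ne indep gauss]) auto
      also have "\<dots> \<le> ennreal (exp (?c * t\<^sup>2) - 1) * estimator_variance (P \<theta>) T"
        using le by (intro mult_right_mono ennreal_leI) auto
      finally show "ennreal ((t * K)\<^sup>2) \<le> ennreal (exp (?c * t\<^sup>2) - 1) * estimator_variance (P \<theta>) T"
        by (simp only: E)
    qed
    \<comment> \<open>For the optimal \<open>v\<close>, the quotient of
      \<open>(v $ 1)\<^sup>2\<close> by the quadratic form is the (1,1) entry of the inverse
      information matrix. The identity is proved for plain reals to keep the sums opaque.\<close>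
    moreover have "K\<^sup>2 / ?c = N0 / (2 * A\<^sup>2) * (K / D)"
    proof -
      have "x\<^sup>2 / (2 * a / n * (x * d)) = n / (2 * a) * (x / d)" if "x > 0" for x a n d :: real
        using that by (simp add: power2_eq_square mult.commute mult.left_commute)
      then show ?thesis using K0 .
    qed
    ultimately show ?thesis by simp
  qed
  have same: "N0 / (2 * real M * A\<^sup>2) * (real (card (S 0)) /
        (real (card (S 0)) * (\<Sum>i\<in>S 0. (2 * pi * \<Delta>f * real i)\<^sup>2) - (\<Sum>i\<in>S 0. 2 * pi * \<Delta>f * real i)\<^sup>2))
      = N0 / (2 * A\<^sup>2) * (K / D)" if S: "\<forall>m<M. S m = S 0"
  proof -
    let ?k = "real (card (S 0))" and ?a = "\<Sum>i\<in>S 0. (2 * pi * \<Delta>f * real i)\<^sup>2"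
      and ?b = "\<Sum>i\<in>S 0. 2 * pi * \<Delta>f * real i"
    have const: "(\<Sum>m<M. f (S m)) = real M * f (S 0)" for f :: "nat set \<Rightarrow> real"
    proof -
      have "(\<Sum>m<M. f (S m)) = (\<Sum>m<M. f (S 0))"
        by (rule sum.cong[OF refl], rule arg_cong[where f = f]) (use S in blast)
      then show ?thesis by simp
    qed
    have K': "K = real M * ?k" and "g1 = real M * ?a" and "g2 = (real M * ?b)\<^sup>2"
      unfolding K_def g1_def g2_def
      using const[of "\<lambda>X. real (card X)"] const[of "\<lambda>X. \<Sum>i\<in>X. (2 * pi * \<Delta>f * real i)\<^sup>2"]
        const[of "\<lambda>X. \<Sum>i\<in>X. 2 * pi * \<Delta>f * real i"]
      by (simp_all only:)
    \<comment> \<open>\<open>K\<close> and \<open>g1\<close> scale with \<open>M\<close>, while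
      \<open>g2\<close>, being the square of a sum, scales with \<open>M\<close> squared. So
      \<open>D\<close> gains two factors and \<open>K / D\<close> loses one.\<close>
    then have D': "D = (real M)\<^sup>2 * (?k * ?a - ?b\<^sup>2)"
      by (simp add: D_def power2_eq_square algebra_simps)
    have scale: "N0 / (2 * m * q) * (k / x) = N0 / (2 * q) * (m * k / (m\<^sup>2 * x))" if "m > 0"
      for m q k x :: real
      using that by (simp add: power2_eq_square)
    show ?thesis
      unfolding K' D' using \<open>M \<ge> 1\<close> by (intro scale) simp
  qed
  show ?thesis
    unfolding D_def[symmetric]
  proof (intro conjI ballI allI impI)
    fix T \<theta> assume "\<forall>m<M. S m = S 0"
      and "unbiased_estimator (observation_space I) P \<Theta> 1 T" "\<theta> \<in> \<Theta>"
    then show "ennreal (N0 / (2 * real M * A\<^sup>2) * (real (card (S 0)) /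
        (real (card (S 0)) * (\<Sum>i\<in>S 0. (2 * pi * \<Delta>f * real i)\<^sup>2)
          - (\<Sum>i\<in>S 0. 2 * pi * \<Delta>f * real i)\<^sup>2))) \<le> estimator_variance (P \<theta>) T"
      using bound by (simp only: same)
  qed (rule dist inv crb bound; assumption?)+
qed

end
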